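(* Let $k$ be a differential field of characteristic $0$ with commuting derivations $\Delta=\{\delta_1,\ldots,\delta_m\}$, $|\Delta|=m\ge 2$, and let $A=k\{x,y\}$ be the algebra of differential polynomials over $k$ in two variables. Let $w=x^{\delta_1}-y^{\delta_2}$ and let $\delta$ be the automorphism of $A$ given by $$\delta(x)=x+w^{\delta_2},\qquad \delta(y)=y+w^{\delta_1}.$$ Then $\delta$ is wild.
   Context: Let $\Theta$ be the free commutative monoid on the set of symbols $\Delta=\{\delta_1,\ldots,\delta_m\}$. A differential field is a field on which $\delta_1,\ldots,\delta_m$ act as pairwise commuting derivations. $k\{x,y\}$ denotes the polynomial algebra $k[x^\theta,y^\theta \mid \theta\in\Theta]$ in the algebraically independent variables $x^\theta,y^\theta$, with $x=x^1$, $y=y^1$, made into a differential algebra by the given action of $\delta_i$ on $k$ and $\delta_i(x^\theta)=x^{\theta\delta_i}$, $\delta_i(y^\theta)=y^{\theta\delta_i}$. For an element $u$, write $u^{\theta}=\theta(u)$. $k\{y\}$ and $k\{x\}$ are the analogous one-variable algebras. $Aut(A)$ is the group of automorphisms of $A$ as a differential $k$-algebra ($k$-algebra automorphisms commuting with all $\delta_i$). An automorphism $\varphi$ is written $\varphi=(f_1,f_2)$ where $\varphi(x)=f_1$, $\varphi(y)=f_2$. Elementary automorphisms are those of the form $(ax+f(y),y)$ or $(x,ay+g(x))$ with $0\ne a\in k$, $f(y)\in k\{y\}$, $g(x)\in k\{x\}$. An automorphism is tame if it lies in the subgroup of $Aut(A)$ generated by all elementary automorphisms, and wild if it is not tame.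 *)

theory Defs
  imports
    "HOL-Library.Cardinality"
    "HOL-Library.Multiset"
    "HOL-Library.Poly_Mapping"
    "HOL-Algebra.Generated_Groups"
begin


section \<open>Differential fields\<close>

definition derivation :: "('r::comm_ring_1 \<Rightarrow> 'r) \<Rightarrow> bool" where
  "derivation d \<longleftrightarrow>
     (\<forall>a b. d (a + b) = d a + d b) \<and> (\<forall>a b. d (a * b) = d a * b + a * d b)"

text \<open>The symbols in \<open>\<Delta>\<close> are the elements of the index type \<open>'d\<close>;
  \<open>D i\<close> is the action of the symbol \<open>i\<close>.\<close>

definition differential_field :: "('d \<Rightarrow> 'k::field \<Rightarrow> 'k) \<Rightarrow> bool" where
  "differential_field D \<longleftrightarrow>
     (\<forall>i. derivation (D i)) \<and> (\<forall>i j a. D i (D j a) = D j (D i a))"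


section \<open>The algebra \<open>k{x,y}\<close>\<close>

text \<open>\<open>'d multiset\<close> is the free commutative monoid \<open>\<Theta>\<close> on \<open>\<Delta>\<close>.  The variable \<open>x\<^sup>\<theta>\<close> is \<open>(Lx, \<theta>)\<close>, and
  \<open>y\<^sup>\<theta>\<close> is \<open>(Ly, \<theta>)\<close>.  A monomial is a multiset of variables, and a polynomial is a
  finitely supported function from monomials to coefficients, with the convolution product
  of \<open>Poly_Mapping\<close>.\<close>

datatype letter = Lx | Ly

type_synonym 'd dvariable = "letter \<times> 'd multiset"
type_synonym ('d, 'k) dpoly = "'d dvariable multiset \<Rightarrow>\<^sub>0 'k"

definition dconst :: "'k::field \<Rightarrow> ('d, 'k) dpoly" where
  "dconst c = Poly_Mapping.single {#} c"

definition dvar :: "letter \<Rightarrow> 'd multiset \<Rightarrow> ('d, 'k::field) dpoly" where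
  "dvar l \<theta> = Poly_Mapping.single {#(l, \<theta>)#} 1"

abbreviation dx :: "('d, 'k::field) dpoly" where "dx \<equiv> dvar Lx {#}"
abbreviation dy :: "('d, 'k::field) dpoly" where "dy \<equiv> dvar Ly {#}"

fun shift :: "'d \<Rightarrow> 'd dvariable \<Rightarrow> 'd dvariable" where
  "shift i (l, \<theta>) = (l, add_mset i \<theta>)"

text \<open>The image of the term \<open>c \<cdot> m\<close> under the symbol \<open>i\<close>, by the Leibniz rule; the multiset sum
  accounts for multiplicities of variables in \<open>m\<close>.\<close>

definition dterm ::
    "('d \<Rightarrow> 'k::field \<Rightarrow> 'k) \<Rightarrow> 'd \<Rightarrow> 'd dvariable multiset \<Rightarrow> 'k \<Rightarrow> ('d, 'k) dpoly" where
  "dterm D i m c =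
     Poly_Mapping.single m (D i c) +
     (\<Sum>v\<in>#m. Poly_Mapping.single (add_mset (shift i v) (m - {#v#})) c)"

definition dact :: "('d \<Rightarrow> 'k::field \<Rightarrow> 'k) \<Rightarrow> 'd \<Rightarrow> ('d, 'k) dpoly \<Rightarrow> ('d, 'k) dpoly" where
  "dact D i p = (\<Sum>m\<in>Poly_Mapping.keys p. dterm D i m (Poly_Mapping.lookup p m))"

text \<open>The subalgebras \<open>k{x}\<close> (for \<open>l = Lx\<close>) and \<open>k{y}\<close> (for \<open>l = Ly\<close>) of \<open>k{x,y}\<close>.\<close>

definition dpoly_in :: "letter \<Rightarrow> ('d, 'k::field) dpoly set" where
  "dpoly_in l = {p. \<forall>m\<in>Poly_Mapping.keys p. \<forall>v\<in>#m. fst v = l}"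


section \<open>Automorphisms\<close>

definition dautomorphism ::
    "('d \<Rightarrow> 'k::field \<Rightarrow> 'k) \<Rightarrow> (('d, 'k) dpoly \<Rightarrow> ('d, 'k) dpoly) \<Rightarrow> bool" where
  "dautomorphism D \<phi> \<longleftrightarrow>
     bij \<phi> \<and>
     (\<forall>p q. \<phi> (p + q) = \<phi> p + \<phi> q) \<and>
     (\<forall>p q. \<phi> (p * q) = \<phi> p * \<phi> q) \<and>
     (\<forall>c. \<phi> (dconst c) = dconst c) \<and>
     (\<forall>i p. \<phi> (dact D i p) = dact D i (\<phi> p))"

definition dAut ::
    "('d \<Rightarrow> 'k::field \<Rightarrow> 'k) \<Rightarrow> (('d, 'k) dpoly \<Rightarrow> ('d, 'k) dpoly) monoid" where
  "dAut D = \<lparr>carrier = {\<phi>. dautomorphism D \<phi>}, mult = (\<circ>), one = id\<rparr>"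

text \<open>\<open>dpair D \<phi> f\<^sub>1 f\<^sub>2\<close> is the notation \<open>\<phi> = (f\<^sub>1, f\<^sub>2)\<close> for automorphisms.\<close>

definition dpair ::
    "('d \<Rightarrow> 'k::field \<Rightarrow> 'k) \<Rightarrow> (('d, 'k) dpoly \<Rightarrow> ('d, 'k) dpoly) \<Rightarrow>
     ('d, 'k) dpoly \<Rightarrow> ('d, 'k) dpoly \<Rightarrow> bool" where
  "dpair D \<phi> f1 f2 \<longleftrightarrow> \<phi> \<in> carrier (dAut D) \<and> \<phi> dx = f1 \<and> \<phi> dy = f2"

definition elementary ::
    "('d \<Rightarrow> 'k::field \<Rightarrow> 'k) \<Rightarrow> (('d, 'k) dpoly \<Rightarrow> ('d, 'k) dpoly) set" where
  "elementary D =
     {\<phi>. \<exists>a f. a \<noteq> 0 \<and> f \<in> dpoly_in Ly \<and> dpair D \<phi> (dconst a * dx + f) dy} \<union>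
     {\<phi>. \<exists>a g. a \<noteq> 0 \<and> g \<in> dpoly_in Lx \<and> dpair D \<phi> dx (dconst a * dy + g)}"

definition tame ::
    "('d \<Rightarrow> 'k::field \<Rightarrow> 'k) \<Rightarrow> (('d, 'k) dpoly \<Rightarrow> ('d, 'k) dpoly) \<Rightarrow> bool" where
  "tame D \<phi> \<longleftrightarrow> \<phi> \<in> generate (dAut D) (elementary D)"

definition wild ::
    "('d \<Rightarrow> 'k::field \<Rightarrow> 'k) \<Rightarrow> (('d, 'k) dpoly \<Rightarrow> ('d, 'k) dpoly) \<Rightarrow> bool" where
  "wild D \<phi> \<longleftrightarrow> \<phi> \<in> carrier (dAut D) \<and> \<not> tame D \<phi>"


section \<open>\<open>k{x,y}\<close> is a differential \<open>k\<close>-algebra, and its automorphisms form a group\<close>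

lemma derivation_simps:
  assumes "derivation d"
  shows "d (a + b) = d a + d b" "d (a * b) = d a * b + a * d b" "d 0 = 0" "d 1 = 0"
proof -
  show add: "d (a + b) = d a + d b" and mult: "d (a * b) = d a * b + a * d b" for a b
    using assms by (simp_all add: derivation_def)
  show "d 0 = 0" using add[of 0 0] by simp
  show "d 1 = 0" using mult[of 1 1] by simp
qed

lemma sum_mset_single_0: "(\<Sum>v\<in>#m. Poly_Mapping.single (f v) 0) = 0"
  by (induction m) auto

lemma dterm_0: "derivation (D i) \<Longrightarrow> dterm D i m 0 = 0"
  by (simp add: dterm_def derivation_simps sum_mset_single_0)

lemma dterm_add: "derivation (D i) \<Longrightarrow> dterm D i m (a + b) = dterm D i m a + dterm D i m b"
  by (simp add: dterm_def derivation_simps single_add sum_mset.distrib algebra_simps)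

lemma dterm_mult:
  assumes "derivation (D i)"
  shows "dterm D i (m + n) (a * b) =
    dterm D i m a * Poly_Mapping.single n b + Poly_Mapping.single m a * dterm D i n b"
proof -
  have 1: "(\<Sum>v\<in>#m. Poly_Mapping.single (add_mset (shift i v) (m + n - {#v#})) (a * b)) =
    (\<Sum>v\<in>#m. Poly_Mapping.single (add_mset (shift i v) (m - {#v#})) a) * Poly_Mapping.single n b"
    for m n a b
    unfolding sum_mset_distrib_right
    by (intro arg_cong[of _ _ sum_mset] image_mset_cong) (simp add: mult_single)
  have 2: "(\<Sum>v\<in>#n. Poly_Mapping.single (add_mset (shift i v) (m + n - {#v#})) (a * b)) =
    Poly_Mapping.single m a * (\<Sum>v\<in>#n. Poly_Mapping.single (add_mset (shift i v) (n - {#v#})) b)"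
    using 1[of n m b a] by (simp add: mult.commute add.commute)
  show ?thesis
    by (simp add: dterm_def derivation_simps[OF assms] 1 2 mult_single single_add algebra_simps)
qed

lemma dact_eq_sum:
  assumes "derivation (D i)" "finite S" "Poly_Mapping.keys p \<subseteq> S"
  shows "dact D i p = (\<Sum>m\<in>S. dterm D i m (Poly_Mapping.lookup p m))"
  unfolding dact_def using assms
  by (intro sum.mono_neutral_left) (auto simp: dterm_0 in_keys_iff)

lemma dact_add:
  assumes "derivation (D i)"
  shows "dact D i (p + q) = dact D i p + dact D i q"
proof -
  let ?S = "Poly_Mapping.keys p \<union> Poly_Mapping.keys q"
  have "Poly_Mapping.keys (p + q) \<subseteq> ?S" by (rule keys_add)
  then show ?thesis
    by (simp add: dact_eq_sum[where D = D and i = i and S = ?S] assms lookup_add dterm_add sum.distrib)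
qed

lemma dact_single:
  "derivation (D i) \<Longrightarrow> dact D i (Poly_Mapping.single m c) = dterm D i m c"
  by (subst dact_eq_sum[where S = "{m}"]) auto

lemma dpoly_induct [case_names single add]:
  fixes p :: "('d, 'k::field) dpoly"
  assumes "\<And>m c. P (Poly_Mapping.single m c)" and "\<And>p q. P p \<Longrightarrow> P q \<Longrightarrow> P (p + q)"
  shows "P p"
proof (induction p rule: update_induct)
  case const
  show ?case using assms(1)[of undefined 0] by simp
next
  case (update f a b)
  have "Poly_Mapping.update a b f = f + Poly_Mapping.single a b"
    using update(1)
    by (intro poly_mapping_eqI) (auto simp: Poly_Mapping.lookup_update lookup_add lookup_single in_keys_iff when_def)
  then show ?case using assms update by simp
qed

theorem derivation_dact:
  assumes "derivation (D i)"
  shows "derivation (dact D i)"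
proof -
  have "dact D i (p * q) = dact D i p * q + p * dact D i q" for p q
  proof (induction p rule: dpoly_induct)
    case (single m a)
    show ?case
      by (induction q rule: dpoly_induct)
        (simp_all add: mult_single dact_single dterm_mult dact_add assms algebra_simps)
  next
    case (add p1 p2)
    then show ?case by (simp add: dact_add assms algebra_simps)
  qed
  then show ?thesis by (simp add: derivation_def dact_add[where D = D and i = i, OF assms])
qed

theorem dact_dconst: "derivation (D i) \<Longrightarrow> dact D i (dconst c) = dconst (D i c)"
  by (simp add: dconst_def dact_single dterm_def)

theorem dact_dvar: "derivation (D i) \<Longrightarrow> dact D i (dvar l \<theta>) = dvar l (add_mset i \<theta>)"
  by (simp add: dvar_def dact_single dterm_def derivation_simps)

theorem dpoly_generators_induct [case_names dconst dvar add mult]: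
  fixes p :: "('d, 'k::field) dpoly"
  assumes 1: "\<And>c. P (dconst c)" and 2: "\<And>l \<theta>. P (dvar l \<theta>)"
    and 3: "\<And>p q. P p \<Longrightarrow> P q \<Longrightarrow> P (p + q)" and 4: "\<And>p q. P p \<Longrightarrow> P q \<Longrightarrow> P (p * q)"
  shows "P p"
proof (induction p rule: dpoly_induct)
  case (single m c)
  show ?case
  proof (induction m)
    case empty
    show ?case using 1[of c] by (simp add: dconst_def)
  next
    case (add v m)
    have "Poly_Mapping.single (add_mset v m) c = dvar (fst v) (snd v) * Poly_Mapping.single m c"
      by (simp add: dvar_def mult_single)
    then show ?case using 2 4 add by simp
  qed
qed (rule 3)

theorem dact_commute:
  assumes "differential_field D"
  shows "dact D i (dact D j p) = dact D j (dact D i p)"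
proof -
  have D: "derivation (D i)" for i
    using assms by (auto simp: differential_field_def)
  have comm: "D i (D j a) = D j (D i a)" for i j a
    using assms by (auto simp: differential_field_def)
  note d = derivation_simps[OF derivation_dact[where D = D, OF D]]
  show ?thesis
    by (induction p rule: dpoly_generators_induct)
      (simp_all add: dact_dconst dact_dvar D comm[of i j] add_mset_commute[of i j] d algebra_simps)
qed

theorem group_dAut: "group (dAut D)"
proof (rule groupI)
  fix \<phi> assume "\<phi> \<in> carrier (dAut D)"
  then have \<phi>: "bij \<phi>" and
    hom: "\<And>p q. \<phi> (p + q) = \<phi> p + \<phi> q" "\<And>p q. \<phi> (p * q) = \<phi> p * \<phi> q"
      "\<And>c. \<phi> (dconst c) = dconst c" "\<And>i p. \<phi> (dact D i p) = dact D i (\<phi> p)"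
    by (simp_all add: dAut_def dautomorphism_def)
  have [simp]: "\<phi> (Hilbert_Choice.inv \<phi> p) = p" for p
    using \<phi> by (simp add: bij_is_surj surj_f_inv_f)
  have inj: "\<phi> p = \<phi> q \<Longrightarrow> p = q" for p q
    using \<phi> by (simp add: bij_def inj_eq)
  have "dautomorphism D (Hilbert_Choice.inv \<phi>)"
    unfolding dautomorphism_def
    by (intro conjI allI bij_imp_bij_inv \<phi>; rule inj) (simp_all add: hom)
  moreover have "Hilbert_Choice.inv \<phi> \<circ> \<phi> = id" using \<phi> by (simp add: bij_def)
  ultimately show "\<exists>\<psi>\<in>carrier (dAut D). \<psi> \<otimes>\<^bsub>dAut D\<^esub> \<phi> = \<one>\<^bsub>dAut D\<^esub>"
    by (auto simp: dAut_def)
qed (auto simp: dAut_def dautomorphism_def bij_comp comp_assoc)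

end

theory Submission
  imports Defs "HOL-Library.Multiset_Order" "HOL-Library.Countable"
begin

text \<open>Wildness is detected on linear parts.  Keep, of each differential polynomial, only the
  coefficients of the monomials \<open>x\<^sup>\<theta>\<close>; this gives an element of the ring \<open>R\<close> of linear differential
  operators over \<open>k\<close>, viewed as a left module over itself.  Composing an automorphism \<open>\<psi>\<close> on the
  right with an elementary automorphism changes the linear parts \<open>(p, q)\<close> of
  \<open>(\<psi>(x), \<psi>(y))\<close> by an elementary move \<open>(p, q) \<mapsto> (c p + P q, q)\<close> or \<open>(p, q) \<mapsto> (p, c q + P p)\<close> with
  \<open>0 \<noteq> c \<in> k\<close> and \<open>P \<in> R\<close>, even when the elementary automorphism is not linear: in the Leibniz
  expansion of \<open>\<psi>(f)\<close> only constant terms multiply the derivatives of \<open>q\<close>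
  (\<open>lin_dhom_dpoly_in\<close>).  Hence a tame automorphism gives a pair that is reachable from \<open>(1, 0)\<close>
  by elementary moves (\<open>reachable_tame\<close>).

  The given automorphism yields the pair \<open>(1 + \<delta>\<^sub>1\<delta>\<^sub>2, \<delta>\<^sub>1\<delta>\<^sub>1)\<close>, one column of the matrix by which
  Cohn showed that elementary matrices do not generate \<open>SL\<^sub>2\<close> of a polynomial ring in two
  variables.  Cohn's normal form of products of elementary matrices works over \<open>R\<close> as well,
  because a nonzero operator is either a scalar or strictly raises leading monomials
  (\<open>opers_cases\<close>).  So every reachable pair comes from \<open>(u, 0)\<close>, with \<open>u\<close> a nonzero scalar, by
  steps \<open>(p, q) \<mapsto> (P p + u q, p)\<close> in which \<open>P\<close> is not a scalar, except perhaps in the last step,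
  up to a scalar factor and the order of the entries (\<open>reach_move\<close>).  Leading monomials multiply along these steps, so the leading monomials of the
  two entries are comparable for divisibility (\<open>reach_leads\<close>).  But \<open>\<delta>\<^sub>1\<delta>\<^sub>2\<close> and \<open>\<delta>\<^sub>1\<delta>\<^sub>1\<close> are not.

  That the two images define an automorphism is a computation: the substitution fixes \<open>w\<close>, and
  therefore replacing \<open>w\<close> by \<open>- w\<close> inverts it.\<close>


section \<open>Leading monomials\<close>

lemma poly_mapping_single_add_induct [case_names single add]:
  fixes p :: "'a \<Rightarrow>\<^sub>0 'b::comm_monoid_add"
  assumes "\<And>m c. P (Poly_Mapping.single m c)" and "\<And>p q. P p \<Longrightarrow> P q \<Longrightarrow> P (p + q)"
  shows "P p"
proof (induction p rule: update_induct)
  case const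
  show ?case using assms(1)[of undefined 0] by simp
next
  case (update f a b)
  have "Poly_Mapping.update a b f = f + Poly_Mapping.single a b"
    using update(1)
    by (intro poly_mapping_eqI)
      (auto simp: Poly_Mapping.lookup_update lookup_add lookup_single in_keys_iff when_def)
  then show ?case using assms update by simp
qed

abbreviation cst :: "'k \<Rightarrow> 'd multiset \<Rightarrow>\<^sub>0 'k::field" where
  "cst c \<equiv> Poly_Mapping.single {#} c"

lemma cst_mult: "cst (a * b) = cst a * cst b"
  by (simp add: mult_single)

lemma lookup_cst_mult [simp]:
  "Poly_Mapping.lookup (cst c * p) \<theta> = c * Poly_Mapping.lookup p \<theta>"
proof -
  have "cst c * p = Poly_Mapping.map ((*) c) p"
    using mult_map_scale_conv_mult[of c p] by simp
  then show ?thesis by (simp add: map.rep_eq when_def)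
qed

text \<open>The symbols carry no order of their own, so they are numbered, and monomials are compared in
  the multiset order of their numbers.  That order is total, compatible with multiplication, and
  has the unit monomial as least element.\<close>

definition rank :: "'d::countable multiset \<Rightarrow> nat multiset" where
  "rank \<theta> = image_mset to_nat \<theta>"

lemma rank_add: "rank (\<alpha> + \<theta>) = rank \<alpha> + rank \<theta>"
  by (simp add: rank_def)

lemma rank_inject: "rank \<alpha> = rank \<theta> \<longleftrightarrow> \<alpha> = \<theta>"
  unfolding rank_def using multiset.inj_map[OF inj_to_nat] by (auto dest: injD)

lemma rank_less_subset: "\<alpha> \<subset># \<theta> \<Longrightarrow> rank \<alpha> < rank \<theta>"
  unfolding rank_def by (intro subset_imp_less_mset image_mset_subset_mono)

definition lower :: "('d::countable multiset \<Rightarrow>\<^sub>0 'k::field) \<Rightarrow> 'd multiset \<Rightarrow> bool" where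
  "lower p \<theta> \<longleftrightarrow> (\<forall>\<eta>\<in>Poly_Mapping.keys p. rank \<eta> < rank \<theta>)"

definition leads :: "('d::countable multiset \<Rightarrow>\<^sub>0 'k::field) \<Rightarrow> 'd multiset \<Rightarrow> bool" where
  "leads p \<theta> \<longleftrightarrow> (\<exists>c r. c \<noteq> 0 \<and> lower r \<theta> \<and> p = Poly_Mapping.single \<theta> c + r)"

lemma lower_0 [simp]: "lower 0 \<theta>"
  by (simp add: lower_def)

lemma lower_single: "rank \<eta> < rank \<theta> \<Longrightarrow> lower (Poly_Mapping.single \<eta> c) \<theta>"
  by (simp add: lower_def)

lemma lower_add: "lower p \<theta> \<Longrightarrow> lower q \<theta> \<Longrightarrow> lower (p + q) \<theta>"
  unfolding lower_def using keys_add by fastforce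

lemma lower_sum: "(\<And>x. x \<in> S \<Longrightarrow> lower (f x) \<theta>) \<Longrightarrow> lower (sum f S) \<theta>"
  by (induction S rule: infinite_finite_induct) (auto intro: lower_add)

lemma lower_less: "lower p \<alpha> \<Longrightarrow> rank \<alpha> < rank \<theta> \<Longrightarrow> lower p \<theta>"
  unfolding lower_def by (meson less_trans)

lemma lower_cst_mult: "lower p \<theta> \<Longrightarrow> lower (cst c * p) \<theta>"
  unfolding lower_def by (auto simp: in_keys_iff)

lemma lower_single_mult: "lower p \<theta> \<Longrightarrow> lower (Poly_Mapping.single \<alpha> c * p) (\<alpha> + \<theta>)"
  unfolding lower_def using keys_mult[of "Poly_Mapping.single \<alpha> c" p]
  by (fastforce simp: rank_add split: if_splits)

lemma leads_keys: "leads p \<theta> \<Longrightarrow> \<theta> \<in> Poly_Mapping.keys p"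
  unfolding leads_def lower_def by (force simp: in_keys_iff lookup_add)

lemma leads_maximal:
  assumes "leads p \<theta>" "\<eta> \<in> Poly_Mapping.keys p"
  shows "rank \<eta> \<le> rank \<theta>"
proof -
  obtain c r where "lower r \<theta>" "p = Poly_Mapping.single \<theta> c + r"
    using assms(1) unfolding leads_def by blast
  then show ?thesis
    using assms(2) keys_add[of "Poly_Mapping.single \<theta> c" r] unfolding lower_def
    by (fastforce split: if_splits)
qed

lemma leads_unique: "leads p \<theta> \<Longrightarrow> leads p \<eta> \<Longrightarrow> \<theta> = \<eta>"
  by (metis leads_keys leads_maximal order_antisym rank_inject)

lemma not_leads_0 [simp]: "\<not> leads 0 \<theta>"
  using leads_keys by force

lemma leads_single: "c \<noteq> 0 \<Longrightarrow> leads (Poly_Mapping.single \<theta> c) \<theta>"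
  unfolding leads_def by (metis add.right_neutral lower_0)

lemma leads_add: "leads p \<theta> \<Longrightarrow> lower q \<theta> \<Longrightarrow> leads (p + q) \<theta>"
  unfolding leads_def by (metis add.assoc lower_add)

lemma leads_lower: "leads p \<alpha> \<Longrightarrow> rank \<alpha> < rank \<theta> \<Longrightarrow> lower p \<theta>"
  unfolding lower_def using leads_maximal by (metis order_le_less_trans)

lemma leads_cst_mult:
  assumes "c \<noteq> 0" "leads p \<theta>"
  shows "leads (cst c * p) \<theta>"
proof -
  obtain b r where "b \<noteq> 0" "lower r \<theta>" "p = Poly_Mapping.single \<theta> b + r"
    using assms(2) unfolding leads_def by blast
  then have "cst c * p = Poly_Mapping.single \<theta> (c * b) + cst c * r" "c * b \<noteq> 0"
    "lower (cst c * r) \<theta>"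
    using assms(1) by (simp_all add: distrib_left mult_single lower_cst_mult)
  then show ?thesis unfolding leads_def by blast
qed

lemma leads_ex:
  assumes "p \<noteq> 0"
  shows "\<exists>\<theta>. leads p \<theta>"
proof -
  let ?K = "Poly_Mapping.keys p"
  have K: "finite (rank ` ?K)" "rank ` ?K \<noteq> {}"
    using assms by auto
  obtain \<theta> where \<theta>: "\<theta> \<in> ?K" "rank \<theta> = Max (rank ` ?K)"
    using Max_in[OF K] by force
  let ?r = "p - Poly_Mapping.single \<theta> (Poly_Mapping.lookup p \<theta>)"
  have "rank \<eta> < rank \<theta>" if "\<eta> \<in> Poly_Mapping.keys ?r" for \<eta>
  proof -
    have "\<eta> \<in> ?K" "\<eta> \<noteq> \<theta>"
      using that by (auto simp: in_keys_iff lookup_minus lookup_single when_def split: if_splits)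
    then have "rank \<eta> \<le> rank \<theta>" "rank \<eta> \<noteq> rank \<theta>"
      using K by (simp_all add: \<theta>(2)[symmetric] rank_inject) (simp add: \<theta>(2))
    then show ?thesis by simp
  qed
  then have "lower ?r \<theta>" by (simp add: lower_def)
  moreover have "p = Poly_Mapping.single \<theta> (Poly_Mapping.lookup p \<theta>) + ?r" by simp
  ultimately show ?thesis
    using \<theta>(1) unfolding leads_def in_keys_iff by blast
qed


section \<open>Linear differential operators\<close>

text \<open>An element \<open>\<Sum>\<theta>. c\<^sub>\<theta> \<theta>\<close> of \<open>'d multiset \<Rightarrow>\<^sub>0 'k\<close> stands for a differential operator with its
  coefficients on the left.  The commutative product of the type is not the product of operators;
  it is used for multiplication by scalars, and in \<open>pd\<close> to multiply by a symbol.\<close>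

locale diff_field =
  fixes D :: "'d::countable \<Rightarrow> 'k::field \<Rightarrow> 'k"
  assumes D: "differential_field D"
begin

lemma derivation_D: "derivation (D i)"
  using D by (auto simp: differential_field_def)

lemmas D_simps [simp] = derivation_simps[OF derivation_D]

lemma D_commute: "D i (D j a) = D j (D i a)"
  using D by (auto simp: differential_field_def)

text \<open>Left multiplication by the symbol \<open>i\<close> in the ring of operators, from the commutation rule
  \<open>\<delta>\<^sub>i c = c \<delta>\<^sub>i + \<delta>\<^sub>i(c)\<close>.\<close>

definition pd :: "'d \<Rightarrow> ('d multiset \<Rightarrow>\<^sub>0 'k) \<Rightarrow> ('d multiset \<Rightarrow>\<^sub>0 'k)" where
  "pd i p = Poly_Mapping.map (D i) p + Poly_Mapping.single {#i#} 1 * p"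

lemma lookup_map_D [simp]:
  "Poly_Mapping.lookup (Poly_Mapping.map (D i) p) \<theta> = D i (Poly_Mapping.lookup p \<theta>)"
  by (simp add: map.rep_eq when_def)

lemma map_D_add:
  "Poly_Mapping.map (D i) (p + q) = Poly_Mapping.map (D i) p + Poly_Mapping.map (D i) q"
  by (intro poly_mapping_eqI) (simp add: lookup_add)

lemma pd_add: "pd i (p + q) = pd i p + pd i q"
  by (simp add: pd_def map_D_add algebra_simps)

lemma pd_single:
  "pd i (Poly_Mapping.single \<theta> c) = Poly_Mapping.single \<theta> (D i c) + Poly_Mapping.single (add_mset i \<theta>) c"
  by (simp add: pd_def mult_single)

lemma pd_0 [simp]: "pd i 0 = 0"
  using pd_add[of i 0 0] by simp

lemma pd_cst_mult: "pd i (cst c * p) = cst (D i c) * p + cst c * pd i p"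
  by (induction p rule: poly_mapping_single_add_induct)
    (simp_all add: pd_add pd_single mult_single single_add algebra_simps)

lemma pd_commute: "pd i (pd j p) = pd j (pd i p)"
  by (induction p rule: poly_mapping_single_add_induct)
    (simp_all add: pd_add pd_single D_commute[of i j] add_mset_commute[of i j] algebra_simps)

lemma lower_pd:
  assumes "lower p \<theta>"
  shows "lower (pd i p) (add_mset i \<theta>)"
proof -
  have "lower (Poly_Mapping.map (D i) p) \<theta>"
    using assms unfolding lower_def by (auto simp: in_keys_iff)
  then have "lower (Poly_Mapping.map (D i) p) (add_mset i \<theta>)"
    by (rule lower_less) (rule rank_less_subset, simp)
  then show ?thesis
    unfolding pd_def using lower_single_mult[OF assms, of "{#i#}" 1] by (simp add: lower_add)
qed

lemma leads_pd:
  assumes "leads p \<theta>"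
  shows "leads (pd i p) (add_mset i \<theta>)"
proof -
  obtain c r where *: "c \<noteq> 0" "lower r \<theta>" "p = Poly_Mapping.single \<theta> c + r"
    using assms unfolding leads_def by blast
  have "pd i p = Poly_Mapping.single (add_mset i \<theta>) c + (Poly_Mapping.single \<theta> (D i c) + pd i r)"
    by (simp add: * pd_add pd_single)
  moreover have "lower (Poly_Mapping.single \<theta> (D i c) + pd i r) (add_mset i \<theta>)"
    using *(2) by (intro lower_add lower_single lower_pd rank_less_subset) simp_all
  ultimately show ?thesis using *(1) unfolding leads_def by blast
qed

definition pds :: "'d multiset \<Rightarrow> ('d multiset \<Rightarrow>\<^sub>0 'k) \<Rightarrow> ('d multiset \<Rightarrow>\<^sub>0 'k)" where
  "pds \<theta> p = fold_mset pd p \<theta>"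

lemma pds_simps [simp]: "pds {#} p = p" "pds (add_mset i \<theta>) p = pd i (pds \<theta> p)"
proof -
  interpret comp_fun_commute pd
    by standard (auto simp: fun_eq_iff pd_commute)
  show "pds {#} p = p" "pds (add_mset i \<theta>) p = pd i (pds \<theta> p)"
    by (simp_all add: pds_def)
qed

lemma leads_pds: "leads p \<theta> \<Longrightarrow> leads (pds \<alpha> p) (\<alpha> + \<theta>)"
  by (induction \<alpha>) (auto intro: leads_pd)

text \<open>The product of the operators \<open>a\<close> and \<open>p\<close>.\<close>

definition oper :: "('d multiset \<Rightarrow>\<^sub>0 'k) \<Rightarrow> ('d multiset \<Rightarrow>\<^sub>0 'k) \<Rightarrow> ('d multiset \<Rightarrow>\<^sub>0 'k)" where
  "oper a p = (\<Sum>\<theta>\<in>Poly_Mapping.keys a. cst (Poly_Mapping.lookup a \<theta>) * pds \<theta> p)"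

lemma oper_eq_sum:
  assumes "finite S" "Poly_Mapping.keys a \<subseteq> S"
  shows "oper a p = (\<Sum>\<theta>\<in>S. cst (Poly_Mapping.lookup a \<theta>) * pds \<theta> p)"
  unfolding oper_def using assms by (intro sum.mono_neutral_left) (auto simp: in_keys_iff)

lemma oper_add: "oper (a + b) p = oper a p + oper b p"
proof -
  let ?S = "Poly_Mapping.keys a \<union> Poly_Mapping.keys b"
  have S: "finite ?S" "Poly_Mapping.keys a \<subseteq> ?S" "Poly_Mapping.keys b \<subseteq> ?S"
    "Poly_Mapping.keys (a + b) \<subseteq> ?S"
    using keys_add[of a b] by auto
  show ?thesis
    unfolding oper_eq_sum[OF S(1,2)] oper_eq_sum[OF S(1,3)] oper_eq_sum[OF S(1,4)]
      lookup_add single_add distrib_right sum.distrib ..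
qed

lemma oper_single: "oper (Poly_Mapping.single \<theta> c) p = cst c * pds \<theta> p"
  by (subst oper_eq_sum[where S = "{\<theta>}"]) auto

lemma oper_cst_mult: "oper (cst c * a) p = cst c * oper a p"
proof (induction a rule: poly_mapping_single_add_induct)
  case (single \<theta> b)
  have "cst c * Poly_Mapping.single \<theta> b = Poly_Mapping.single \<theta> (c * b)"
    by (simp add: mult_single)
  then show ?case by (simp only: oper_single cst_mult mult.assoc)
next
  case (add a b)
  then show ?case by (simp add: distrib_left oper_add)
qed

lemma oper_pd: "oper (pd i a) p = pd i (oper a p)"
  by (induction a rule: poly_mapping_single_add_induct)
    (simp_all add: oper_add oper_single pd_add pd_single pd_cst_mult)

text \<open>The ring of operators has the leading monomials of a domain: commuting a symbol past a
  coefficient only creates lower terms.\<close>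

lemma leads_oper:
  assumes a: "leads a \<alpha>" and p: "leads p \<theta>"
  shows "leads (oper a p) (\<alpha> + \<theta>)"
proof -
  obtain c r where *: "c \<noteq> 0" "lower r \<alpha>" "a = Poly_Mapping.single \<alpha> c + r"
    using a unfolding leads_def by blast
  have "lower (oper r p) (\<alpha> + \<theta>)"
    unfolding oper_def using *(2)
    by (intro lower_sum lower_cst_mult leads_lower[OF leads_pds[OF p]])
      (simp add: lower_def rank_add)
  then show ?thesis
    unfolding *(3) oper_add oper_single
    by (intro leads_add leads_cst_mult leads_pds p *)
qed

text \<open>Left multiplications by operators, generated as maps so that closure under composition is
  immediate; \<open>opers_normal_form\<close> recovers the coefficients.\<close>

inductive_set opers :: "(('d multiset \<Rightarrow>\<^sub>0 'k) \<Rightarrow> ('d multiset \<Rightarrow>\<^sub>0 'k)) set" where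
  cst: "(\<lambda>p. cst c * p) \<in> opers"
| smult: "P \<in> opers \<Longrightarrow> (\<lambda>p. cst c * P p) \<in> opers"
| pd: "P \<in> opers \<Longrightarrow> (\<lambda>p. pd i (P p)) \<in> opers"
| add: "P \<in> opers \<Longrightarrow> Q \<in> opers \<Longrightarrow> (\<lambda>p. P p + Q p) \<in> opers"

lemma opers_id: "(\<lambda>p. p) \<in> opers"
  using opers.cst[of 1] unfolding single_one mult_1 .

lemma opers_zero: "(\<lambda>p. 0) \<in> opers"
  using opers.cst[of 0] unfolding single_zero mult_zero_left .

lemma opers_comp: "P \<in> opers \<Longrightarrow> Q \<in> opers \<Longrightarrow> (\<lambda>p. P (Q p)) \<in> opers"
proof (induction P rule: opers.induct)
  case (cst c)
  then show ?case by (rule opers.smult)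
next
  case (smult P c)
  then show ?case by (intro opers.smult)
next
  case (pd P i)
  then show ?case by (intro opers.pd)
next
  case (add P1 P2)
  then show ?case by (intro opers.add)
qed

lemma opers_additive: "P \<in> opers \<Longrightarrow> P (p + q) = P p + P q"
  by (induction P rule: opers.induct) (simp_all add: distrib_left pd_add)

lemma opers_normal_form: "P \<in> opers \<Longrightarrow> \<exists>a. \<forall>p. P p = oper a p"
proof (induction P rule: opers.induct)
  case (cst c)
  have "\<forall>p. cst c * p = oper (cst c) p" by (simp add: oper_single)
  then show ?case by blast
next
  case (smult P c)
  then show ?case by (metis oper_cst_mult)
next
  case (pd P i)
  then show ?case by (metis oper_pd)
next
  case (add P Q)
  then show ?case by (metis oper_add)
qed

definition raising :: "(('d multiset \<Rightarrow>\<^sub>0 'k) \<Rightarrow> ('d multiset \<Rightarrow>\<^sub>0 'k)) \<Rightarrow> bool" where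
  "raising P \<longleftrightarrow> (\<exists>\<alpha>. \<alpha> \<noteq> {#} \<and> (\<forall>p \<theta>. leads p \<theta> \<longrightarrow> leads (P p) (\<alpha> + \<theta>)))"

text \<open>The unit monomial is the least one, so an operator led by it has no other term.\<close>

lemma opers_cases:
  assumes "P \<in> opers"
  obtains (scalar) c where "\<And>p. P p = cst c * p" | (raising) "raising P"
proof -
  obtain a where a: "\<And>p. P p = oper a p"
    using opers_normal_form[OF assms] by blast
  show thesis
  proof (cases "a = 0")
    case True
    then show ?thesis by (intro scalar[of 0]) (simp add: a oper_def)
  next
    case False
    then obtain \<alpha> where \<alpha>: "leads a \<alpha>" using leads_ex by blast
    show ?thesis
    proof (cases "\<alpha> = {#}")
      case False
      then show ?thesis
        using \<alpha> leads_oper by (intro raising) (auto simp: raising_def a)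
    next
      case True
      then obtain c r where "lower r {#}" "a = cst c + r"
        using \<alpha> unfolding leads_def by blast
      moreover from this have "r = 0"
        by (simp add: lower_def rank_def)
      ultimately have "a = cst c" by simp
      then show ?thesis by (intro scalar[of c]) (simp add: a oper_single)
    qed
  qed
qed

lemma raising_add_cst:
  assumes "raising P"
  shows "raising (\<lambda>p. P p + cst c * p)"
proof -
  obtain \<alpha> where \<alpha>: "\<alpha> \<noteq> {#}" "\<And>p \<theta>. leads p \<theta> \<Longrightarrow> leads (P p) (\<alpha> + \<theta>)"
    using assms unfolding raising_def by blast
  have "rank \<theta> < rank (\<alpha> + \<theta>)" for \<theta>
    by (rule rank_less_subset) (simp add: \<alpha> subset_mset.less_le)
  then show ?thesis
    unfolding raising_def using \<alpha>
    by (intro exI[of _ \<alpha>] conjI allI impI leads_add lower_cst_mult) (auto intro: leads_lower)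
qed

lemma raising_smult: "raising P \<Longrightarrow> c \<noteq> 0 \<Longrightarrow> raising (\<lambda>p. cst c * P p)"
  unfolding raising_def
  by (elim exE conjE, rule exI, intro conjI allI impI leads_cst_mult) auto


section \<open>Pairs reachable by elementary moves\<close>

text \<open>Cohn's normal form: the pairs produced by a Euclidean algorithm run backwards, with no scalar
  among the quotients.\<close>

inductive normal :: "('d multiset \<Rightarrow>\<^sub>0 'k) \<Rightarrow> ('d multiset \<Rightarrow>\<^sub>0 'k) \<Rightarrow> bool" where
  unit: "u \<noteq> 0 \<Longrightarrow> normal (cst u) 0"
| step: "normal p q \<Longrightarrow> P \<in> opers \<Longrightarrow> raising P \<Longrightarrow> u \<noteq> 0 \<Longrightarrow> normal (P p + cst u * q) p"

text \<open>One last quotient \<open>P\<close> is arbitrary.  This is what makes the set of pairs stable under all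
  moves: \<open>P\<close> absorbs the moves that change \<open>f\<close>, and a scalar \<open>P\<close> can be merged with its predecessor
  when a move changes \<open>g\<close>.\<close>

definition reach1 :: "('d multiset \<Rightarrow>\<^sub>0 'k) \<Rightarrow> ('d multiset \<Rightarrow>\<^sub>0 'k) \<Rightarrow> bool" where
  "reach1 f g \<longleftrightarrow> (\<exists>p q P u v. normal p q \<and> P \<in> opers \<and> u \<noteq> 0 \<and> v \<noteq> 0 \<and>
      f = P p + cst u * q \<and> g = cst v * p)"

lemma reach1I:
  "normal p q \<Longrightarrow> P \<in> opers \<Longrightarrow> u \<noteq> 0 \<Longrightarrow> v \<noteq> 0 \<Longrightarrow> f = P p + cst u * q \<Longrightarrow> g = cst v * p
    \<Longrightarrow> reach1 f g"
  unfolding reach1_def by blast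

definition reach :: "('d multiset \<Rightarrow>\<^sub>0 'k) \<Rightarrow> ('d multiset \<Rightarrow>\<^sub>0 'k) \<Rightarrow> bool" where
  "reach f g \<longleftrightarrow> reach1 f g \<or> reach1 g f"

lemma normal_leads:
  "normal p q \<Longrightarrow> \<exists>\<theta>. leads p \<theta> \<and> (q = 0 \<or> (\<exists>\<eta>. leads q \<eta> \<and> \<eta> \<subset># \<theta>))"
proof (induction rule: normal.induct)
  case (unit u)
  then show ?case using leads_single by blast
next
  case (step p q P u)
  then obtain \<theta> where \<theta>: "leads p \<theta>" and q: "q = 0 \<or> (\<exists>\<eta>. leads q \<eta> \<and> \<eta> \<subset># \<theta>)"
    by blast
  obtain \<alpha> where \<alpha>: "\<alpha> \<noteq> {#}" "leads (P p) (\<alpha> + \<theta>)"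
    using step(3) \<theta> unfolding raising_def by blast
  have sub: "\<theta> \<subset># \<alpha> + \<theta>" by (simp add: \<alpha> subset_mset.less_le)
  have "lower (cst u * q) (\<alpha> + \<theta>)"
  proof (cases "q = 0")
    case False
    then obtain \<eta> where \<eta>: "leads q \<eta>" "\<eta> \<subset># \<theta>" using q by blast
    show ?thesis
      by (rule lower_cst_mult, rule leads_lower[OF \<eta>(1)], rule rank_less_subset)
        (rule subset_mset.less_trans[OF \<eta>(2) sub])
  qed simp
  then have "leads (P p + cst u * q) (\<alpha> + \<theta>)" using \<alpha> by (intro leads_add)
  then show ?case using \<theta> sub by blast
qed

lemma reach1_move1:
  assumes "reach1 f g" "c \<noteq> 0" "Q \<in> opers"
  shows "reach1 (cst c * f + Q g) g"
proof -
  obtain p q P u v where *: "normal p q" "P \<in> opers" "u \<noteq> 0" "v \<noteq> 0"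
    "f = P p + cst u * q" "g = cst v * p"
    using assms(1) unfolding reach1_def by blast
  have "(\<lambda>p. cst c * P p + Q (cst v * p)) \<in> opers"
    by (intro opers.add opers.smult opers_comp[OF assms(3) opers.cst] *)
  with *(1) show ?thesis
    by (rule reach1I[where u = "c * u" and v = v])
      (use * assms in \<open>simp_all add: algebra_simps cst_mult\<close>)
qed

text \<open>If the last quotient raises, then \<open>(f, p)\<close> is itself normal and the move adds a quotient.
  If it is a nonzero scalar, then \<open>(f, q)\<close> is normal, since the quotient before it absorbs the
  scalar, and \<open>p\<close> is a scalar combination of \<open>f\<close> and \<open>q\<close>.  If it is zero, then \<open>f\<close> is a scalar
  multiple of \<open>q\<close>, and the move acts on the quotient before it; at the start of the algorithm there
  is none, but then \<open>f = 0\<close> and the move only rescales \<open>g\<close>.\<close>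

lemma reach_move2:
  assumes "reach1 f g" "c \<noteq> 0" "Q \<in> opers"
  shows "reach f (cst c * g + Q f)"
proof -
  obtain p q P u v where *: "normal p q" "P \<in> opers" "u \<noteq> 0" "v \<noteq> 0"
    "f = P p + cst u * q" "g = cst v * p"
    using assms(1) unfolding reach1_def by blast
  from *(2) show ?thesis
  proof (cases rule: opers_cases)
    case raising
    then have n: "normal f p" unfolding *(5) by (intro normal.step *)
    have "reach1 (cst c * g + Q f) f"
      by (rule reach1I[OF n assms(3), of "c * v" 1])
        (use * assms in \<open>simp_all add: cst_mult algebra_simps\<close>)
    then show ?thesis by (simp add: reach_def)
  next
    case (scalar a)
    then have f: "f = cst a * p + cst u * q" using * by simp
    show ?thesis
    proof (cases "a = 0")
      case a: False
      have n: "normal f q"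
        using *(1)
      proof cases
        case (unit w)
        have "f = cst (a * w)" using unit f by (simp add: mult_single)
        moreover have "normal (cst (a * w)) 0" using unit a by (intro normal.unit) simp
        ultimately show ?thesis using unit by simp
      next
        case (step q' P' w)
        let ?P = "\<lambda>p. cst a * P' p + cst u * p"
        have "normal (?P q + cst (a * w) * q') q"
          using step a by (intro normal.step raising_add_cst raising_smult opers.intros) auto
        moreover have "f = ?P q + cst (a * w) * q'"
          by (simp add: f step cst_mult algebra_simps)
        ultimately show ?thesis by simp
      qed
      have ai: "cst (inverse a) * cst a = cst 1" using a by (simp add: mult_single)
      let ?Q = "\<lambda>p. cst (c * v * inverse a) * p + Q p"
      have "cst (c * v * inverse a) * (cst a * p) = cst (c * v) * p"
        using a by (simp add: mult.assoc[symmetric] mult_single) (simp add: mult.assoc)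
      then have "cst c * g = cst (c * v * inverse a) * (f - cst u * q)"
        by (simp add: f * cst_mult algebra_simps)
      then have "cst c * g + Q f = ?Q f + cst (- (c * v * inverse a * u)) * q"
        by (simp add: algebra_simps cst_mult single_uminus)
      then have "reach1 (cst c * g + Q f) f"
        using n * assms a
        by (intro reach1I[where P = ?Q and p = f and q = q and u = "- (c * v * inverse a * u)" and v = 1])
          (auto intro!: opers.intros)
      then show ?thesis by (simp add: reach_def)
    next
      case a: True
      then have f: "f = cst u * q" using f by simp
      from *(1) show ?thesis
      proof cases
        case (unit w)
        then have "f = 0" using f by simp
        moreover have "Q 0 = 0" using opers_additive[OF assms(3), of 0 0] by simp
        ultimately have "reach1 f (cst c * g + Q f)"
          using *(1) unit \<open>c \<noteq> 0\<close>
          by (intro reach1I[OF *(1) opers_zero, of 1 "c * v"])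
            (simp_all add: * cst_mult mult.assoc)
        then show ?thesis by (simp add: reach_def)
      next
        case (step q' P' w)
        let ?P = "\<lambda>p. cst (c * v) * P' p + Q (cst u * p)"
        have P: "?P \<in> opers"
          using step by (intro opers.add opers.smult opers_comp[OF assms(3) opers.cst])
        have "cst c * g + Q f = ?P q + cst (c * v * w) * q'"
          by (simp add: f * step cst_mult algebra_simps)
        then have "reach1 (cst c * g + Q f) f"
          using step * assms f by (intro reach1I[OF step(2) P, of "c * v * w" u]) auto
        then show ?thesis by (simp add: reach_def)
      qed
    qed
  qed
qed

lemma reach_sym: "reach f g \<Longrightarrow> reach g f"
  by (auto simp: reach_def)

lemma reach_move:
  assumes "reach f g" "c \<noteq> 0" "Q \<in> opers"
  shows "reach (cst c * f + Q g) g"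
  using assms(1) reach1_move1[OF _ assms(2,3)] reach_move2[OF _ assms(2,3)] reach_sym
  unfolding reach_def by blast

lemma reach_start: "reach (cst 1) 0"
proof -
  have "reach1 0 (cst 1)"
    by (rule reach1I[OF normal.unit[of 1] opers_zero, of 1 1]) simp_all
  then show ?thesis by (simp add: reach_def)
qed

text \<open>The last quotient multiplies the leading monomial of \<open>g\<close> when it raises, keeps it when it is a
  nonzero scalar, and when it is zero \<open>f\<close> is led by a divisor of it.\<close>

lemma reach1_leads:
  assumes "reach1 f g" "leads f \<alpha>" "leads g \<beta>"
  shows "\<alpha> \<subseteq># \<beta> \<or> \<beta> \<subseteq># \<alpha>"
proof -
  obtain p q P u v where *: "normal p q" "P \<in> opers" "u \<noteq> 0" "v \<noteq> 0"
    "f = P p + cst u * q" "g = cst v * p"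
    using assms(1) unfolding reach1_def by blast
  obtain \<theta> where \<theta>: "leads p \<theta>" and q: "q = 0 \<or> (\<exists>\<eta>. leads q \<eta> \<and> \<eta> \<subset># \<theta>)"
    using normal_leads[OF *(1)] by blast
  have \<beta>: "\<beta> = \<theta>" using leads_unique[OF assms(3)] leads_cst_mult[OF *(4) \<theta>] * by simp
  have low: "lower (cst u * q) \<theta>"
  proof (cases "q = 0")
    case False
    then obtain \<eta> where \<eta>: "leads q \<eta>" "\<eta> \<subset># \<theta>" using q by blast
    show ?thesis
      by (intro lower_cst_mult leads_lower[OF \<eta>(1)] rank_less_subset \<eta>(2))
  qed simp
  from *(2) show ?thesis
  proof (cases rule: opers_cases)
    case (scalar a)
    show ?thesis
    proof (cases "a = 0")
      case True
      then have f: "f = cst u * q" using scalar * by simp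
      then have "q \<noteq> 0" using assms(2) by auto
      then obtain \<eta> where "leads q \<eta>" "\<eta> \<subset># \<theta>" using q by blast
      then have "\<alpha> = \<eta>" using leads_unique[OF assms(2)] leads_cst_mult[OF *(3)] f by blast
      then show ?thesis using \<beta> \<open>\<eta> \<subset># \<theta>\<close> by auto
    next
      case False
      then have "leads f \<theta>"
        using * scalar \<theta> low by (auto intro: leads_add leads_cst_mult)
      then show ?thesis using leads_unique[OF assms(2)] \<beta> by auto
    qed
  next
    case raising
    then obtain \<gamma> where \<gamma>: "\<gamma> \<noteq> {#}" "leads (P p) (\<gamma> + \<theta>)"
      using \<theta> unfolding raising_def by blast
    have "rank \<theta> < rank (\<gamma> + \<theta>)"
      by (rule rank_less_subset) (simp add: \<gamma> subset_mset.less_le)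
    moreover have "lower (cst u * q) (\<gamma> + \<theta>)" using low calculation by (rule lower_less)
    ultimately have "leads f (\<gamma> + \<theta>)" using \<gamma> * by (auto intro: leads_add)
    then have "\<alpha> = \<gamma> + \<theta>" using leads_unique[OF assms(2)] by blast
    then show ?thesis using \<beta> by simp
  qed
qed

lemma reach_leads: "reach f g \<Longrightarrow> leads f \<alpha> \<Longrightarrow> leads g \<beta> \<Longrightarrow> \<alpha> \<subseteq># \<beta> \<or> \<beta> \<subseteq># \<alpha>"
  unfolding reach_def using reach1_leads by blast


section \<open>The linear part of a differential polynomial\<close>

text \<open>The coefficients of the \<open>y\<^sup>\<theta>\<close> are dropped: one of the two rows of the linear part suffices.\<close>

definition lin :: "('d, 'k) dpoly \<Rightarrow> ('d multiset \<Rightarrow>\<^sub>0 'k)" where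
  "lin p = Poly_Mapping.map_key (\<lambda>\<theta>. {#(Lx, \<theta>)#}) p"

definition const_part :: "('d, 'k) dpoly \<Rightarrow> 'k" where
  "const_part p = Poly_Mapping.lookup p {#}"

lemma lookup_lin: "Poly_Mapping.lookup (lin p) \<theta> = Poly_Mapping.lookup p {#(Lx, \<theta>)#}"
  unfolding lin_def by (subst map_key.rep_eq) (auto simp: inj_def)

lemma lin_add: "lin (p + q) = lin p + lin q"
  by (intro poly_mapping_eqI) (simp add: lookup_lin lookup_add)

lemma lin_0 [simp]: "lin 0 = 0"
  by (intro poly_mapping_eqI) (simp add: lookup_lin)

lemma lin_diff: "lin (p - q) = lin p - lin q"
  by (intro poly_mapping_eqI) (simp add: lookup_lin lookup_minus)

lemma lookup_mult_singleton:
  "Poly_Mapping.lookup (p * q) {#v#} =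
    Poly_Mapping.lookup p {#} * Poly_Mapping.lookup q {#v#} +
    Poly_Mapping.lookup q {#} * Poly_Mapping.lookup p {#v#}"
  for p q :: "'a multiset \<Rightarrow>\<^sub>0 'k"
proof (induction p rule: poly_mapping_single_add_induct)
  case (single m a)
  show ?case
  proof (induction q rule: poly_mapping_single_add_induct)
    case (single n b)
    show ?case
      by (auto simp: mult_single lookup_single when_def union_is_single)
  qed (simp add: lookup_add algebra_simps)
qed (simp add: lookup_add algebra_simps)

lemma lin_mult: "lin (p * q) = cst (const_part p) * lin q + cst (const_part q) * lin p"
  by (intro poly_mapping_eqI) (simp add: lookup_lin lookup_add const_part_def lookup_mult_singleton)

lemma lin_dconst [simp]: "lin (dconst c) = 0"
  by (intro poly_mapping_eqI) (simp add: lookup_lin dconst_def lookup_single)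

lemma lin_dvar_Lx [simp]: "lin (dvar Lx \<theta>) = Poly_Mapping.single \<theta> 1"
  by (intro poly_mapping_eqI) (auto simp: lookup_lin dvar_def lookup_single when_def)

lemma lin_dvar_Ly [simp]: "lin (dvar Ly \<theta>) = 0"
  by (intro poly_mapping_eqI) (auto simp: lookup_lin dvar_def lookup_single when_def)

lemma const_part_simps:
  "const_part (dconst c) = c" "const_part (dvar l \<theta>) = 0"
  "const_part (p + q) = const_part p + const_part q"
  by (simp_all add: const_part_def dconst_def dvar_def lookup_add lookup_single when_def)

lemma const_part_mult: "const_part (p * q) = const_part p * const_part q"
proof (induction p rule: poly_mapping_single_add_induct)
  case (single m a)
  show ?case
  proof (induction q rule: poly_mapping_single_add_induct)
    case (single n b)
    show ?case
      by (auto simp: const_part_def mult_single lookup_single when_def)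
  qed (simp add: const_part_simps algebra_simps)
qed (simp add: const_part_simps algebra_simps)

lemma dact_plus: "dact D i (p + q) = dact D i p + dact D i q"
  and dact_mult: "dact D i (p * q) = dact D i p * q + p * dact D i q"
  and dact_diff: "dact D i (p - q) = dact D i p - dact D i q"
proof -
  note d = derivation_simps[OF derivation_dact[of D i, OF derivation_D]]
  show "dact D i (p + q) = dact D i p + dact D i q"
    "dact D i (p * q) = dact D i p * q + p * dact D i q" by (rule d)+
  show "dact D i (p - q) = dact D i p - dact D i q"
    using d(1)[of "p - q" q] by simp
qed

lemma dact_const: "dact D i (dconst c) = dconst (D i c)"
  by (rule dact_dconst[OF derivation_D])

lemma dact_var: "dact D i (dvar l \<theta>) = dvar l (add_mset i \<theta>)"
  by (rule dact_dvar[OF derivation_D])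

lemma const_part_dact: "const_part (dact D i p) = D i (const_part p)"
  by (induction p rule: dpoly_generators_induct)
    (simp_all add: dact_const dact_var dact_plus dact_mult const_part_simps const_part_mult)

lemma lin_dact: "lin (dact D i p) = pd i (lin p)"
proof (induction p rule: dpoly_generators_induct)
  case (dvar l \<theta>)
  show ?case by (cases l) (simp_all add: dact_var pd_single)
next
  case (mult p q)
  then show ?case
    by (simp add: dact_mult lin_add lin_mult pd_add pd_cst_mult const_part_dact distrib_left
        add.commute add.left_commute)
qed (simp_all add: dact_const dact_plus lin_add pd_add)


section \<open>Differential endomorphisms\<close>

definition dhom :: "(('d, 'k) dpoly \<Rightarrow> ('d, 'k) dpoly) \<Rightarrow> bool" where
  "dhom \<phi> \<longleftrightarrow>
     (\<forall>p q. \<phi> (p + q) = \<phi> p + \<phi> q) \<and> (\<forall>p q. \<phi> (p * q) = \<phi> p * \<phi> q) \<and>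
     (\<forall>c. \<phi> (dconst c) = dconst c) \<and> (\<forall>i p. \<phi> (dact D i p) = dact D i (\<phi> p))"

lemma in_dAut_iff: "\<phi> \<in> carrier (dAut D) \<longleftrightarrow> bij \<phi> \<and> dhom \<phi>"
  by (simp add: dAut_def dautomorphism_def dhom_def)

lemma dhomD:
  assumes "dhom \<phi>"
  shows "\<phi> (p + q) = \<phi> p + \<phi> q" "\<phi> (p * q) = \<phi> p * \<phi> q" "\<phi> (dconst c) = dconst c"
    "\<phi> (dact D i p) = dact D i (\<phi> p)"
  using assms by (simp_all add: dhom_def)

lemma dhom_0: "dhom \<phi> \<Longrightarrow> \<phi> 0 = 0"
  using dhomD(1)[of \<phi> 0 0] by simp

lemma dhom_diff: "dhom \<phi> \<Longrightarrow> \<phi> (p - q) = \<phi> p - \<phi> q"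
  using dhomD(1)[of \<phi> "p - q" q] by simp

lemma dhom_id: "dhom id"
  by (simp add: dhom_def)

lemma dhom_comp: "dhom \<phi> \<Longrightarrow> dhom \<psi> \<Longrightarrow> dhom (\<phi> \<circ> \<psi>)"
  by (simp add: dhom_def)

lemma dhom_eq_on_vars:
  assumes "dhom \<phi>" "dhom \<psi>" "\<phi> (dvar l {#}) = \<psi> (dvar l {#})"
  shows "\<phi> (dvar l \<theta>) = \<psi> (dvar l \<theta>)"
proof (induction \<theta>)
  case (add i \<theta>)
  then show ?case using dhomD(4)[OF assms(1)] dhomD(4)[OF assms(2)] dact_var by metis
qed (rule assms(3))

lemma dhom_eqI:
  assumes "dhom \<phi>" "dhom \<psi>" "\<phi> dx = \<psi> dx" "\<phi> dy = \<psi> dy"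
  shows "\<phi> = \<psi>"
proof
  fix p
  show "\<phi> p = \<psi> p"
  proof (induction p rule: dpoly_generators_induct)
    case (dvar l \<theta>)
    show ?case using assms by (cases l) (blast intro: dhom_eq_on_vars)+
  qed (simp_all add: dhomD[OF assms(1)] dhomD[OF assms(2)])
qed

lemma dconst_add: "dconst (a + b) = dconst a + dconst b"
  by (simp add: dconst_def single_add)

lemma dconst_mult: "dconst (a * b) = dconst a * dconst b"
  by (simp add: dconst_def mult_single)

definition subst :: "('d dvariable \<Rightarrow> ('d, 'k) dpoly) \<Rightarrow> ('d, 'k) dpoly \<Rightarrow> ('d, 'k) dpoly" where
  "subst g p = (\<Sum>m\<in>Poly_Mapping.keys p. dconst (Poly_Mapping.lookup p m) * (\<Prod>v\<in>#m. g v))"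

lemma subst_eq_sum:
  assumes "finite S" "Poly_Mapping.keys p \<subseteq> S"
  shows "subst g p = (\<Sum>m\<in>S. dconst (Poly_Mapping.lookup p m) * (\<Prod>v\<in>#m. g v))"
  unfolding subst_def using assms
  by (intro sum.mono_neutral_left) (auto simp: in_keys_iff dconst_def)

lemma subst_add: "subst g (p + q) = subst g p + subst g q"
proof -
  let ?S = "Poly_Mapping.keys p \<union> Poly_Mapping.keys q"
  have S: "finite ?S" "Poly_Mapping.keys p \<subseteq> ?S" "Poly_Mapping.keys q \<subseteq> ?S"
    "Poly_Mapping.keys (p + q) \<subseteq> ?S"
    using keys_add[of p q] by auto
  show ?thesis
    unfolding subst_eq_sum[OF S(1,2)] subst_eq_sum[OF S(1,3)] subst_eq_sum[OF S(1,4)]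
      lookup_add dconst_add distrib_right sum.distrib ..
qed

lemma subst_single: "subst g (Poly_Mapping.single m c) = dconst c * (\<Prod>v\<in>#m. g v)"
  by (subst subst_eq_sum[where S = "{m}"]) auto

lemma subst_mult: "subst g (p * q) = subst g p * subst g q"
proof (induction p rule: dpoly_induct)
  case (single m a)
  show ?case
  proof (induction q rule: dpoly_induct)
    case (single n b)
    show ?case
      by (simp add: mult_single subst_single dconst_mult ac_simps)
  qed (simp add: subst_add distrib_left)
qed (simp add: subst_add distrib_right)

lemma subst_dconst: "subst g (dconst c) = dconst c"
  using subst_single[of g "{#}" c] by (simp add: dconst_def)

lemma subst_dvar: "subst g (dvar l \<theta>) = g (l, \<theta>)"
  using subst_single[of g "{#(l, \<theta>)#}" 1] by (simp add: dvar_def dconst_def)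

text \<open>\<open>k{x,y}\<close> is free on \<open>x\<close>, \<open>y\<close> as a differential algebra.\<close>

lemma dhom_exists: "\<exists>\<phi>. dhom \<phi> \<and> \<phi> dx = f \<and> \<phi> dy = g"
proof -
  interpret comp_fun_commute "dact D"
    by standard (auto simp: fun_eq_iff dact_commute[OF D])
  define G where "G = (\<lambda>(l, \<theta>). fold_mset (dact D) (case l of Lx \<Rightarrow> f | Ly \<Rightarrow> g) \<theta>)"
  have G: "G (l, add_mset i \<theta>) = dact D i (G (l, \<theta>))" for l i \<theta>
    by (simp add: G_def)
  have "subst G (dact D i p) = dact D i (subst G p)" for i p
    by (induction p rule: dpoly_generators_induct)
      (simp_all add: dact_const dact_var dact_plus dact_mult subst_add subst_mult subst_dconst
        subst_dvar G)
  then have "dhom (subst G)"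
    by (simp add: dhom_def subst_add subst_mult subst_dconst)
  moreover have "subst G dx = f" "subst G dy = g"
    by (simp_all add: subst_dvar G_def)
  ultimately show ?thesis by blast
qed

lemma dpoly_in_induct:
  assumes "f \<in> dpoly_in l"
    and "\<And>m c. (\<And>v. v \<in># m \<Longrightarrow> fst v = l) \<Longrightarrow> R (Poly_Mapping.single m c)"
    and "R 0" "\<And>p q. R p \<Longrightarrow> R q \<Longrightarrow> R (p + q)"
  shows "R f"
proof -
  have "R (\<Sum>m\<in>S. Poly_Mapping.single m (Poly_Mapping.lookup f m))"
    if "S \<subseteq> Poly_Mapping.keys f" for S
    using that
  proof (induction S rule: infinite_finite_induct)
    case (insert m S)
    then show ?case using assms(1) by (auto intro!: assms(2,4) simp: dpoly_in_def)
  qed (simp_all add: assms(3))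
  moreover have "(\<Sum>m\<in>Poly_Mapping.keys f. Poly_Mapping.single m (Poly_Mapping.lookup f m)) = f"
    by (intro poly_mapping_eqI)
      (simp add: lookup_sum lookup_single when_def sum.delta in_keys_iff)
  ultimately show ?thesis by force
qed

text \<open>The key fact about nonlinear \<open>f\<close>: a product contributes to the linear part only through the
  constant term of one factor times the linear part of the other.  The operator depends on \<open>\<phi>\<close>
  through these constant terms, so \<open>\<phi>\<close> need not fix the origin.\<close>

lemma lin_dhom_dpoly_in:
  assumes "dhom \<phi>" "f \<in> dpoly_in l"
  shows "\<exists>P\<in>opers. lin (\<phi> f) = P (lin (\<phi> (dvar l {#})))"
proof -
  let ?z = "lin (\<phi> (dvar l {#}))"
  note \<phi> = dhomD[OF assms(1)]
  have "\<exists>P\<in>opers. lin (\<phi> (dvar l \<theta>)) = P ?z" for \<theta>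
  proof (induction \<theta>)
    case empty
    show ?case using opers_id by (intro bexI[of _ "\<lambda>p. p"]) auto
  next
    case (add i \<theta>)
    then obtain P where P: "P \<in> opers" "lin (\<phi> (dvar l \<theta>)) = P ?z" by blast
    have "lin (\<phi> (dvar l (add_mset i \<theta>))) = pd i (P ?z)"
      by (simp add: dact_var[symmetric] \<phi> lin_dact P)
    then show ?case using opers.pd[OF P(1), of i] by (intro bexI[of _ "\<lambda>p. pd i (P p)"]) auto
  qed
  note var = this
  show ?thesis
    using assms(2)
  proof (rule dpoly_in_induct)
    show "\<exists>P\<in>opers. lin (\<phi> 0) = P ?z"
      using opers_zero by (intro bexI[of _ "\<lambda>p. 0"]) (auto simp: dhom_0 assms)
  next
    fix p q assume "\<exists>P\<in>opers. lin (\<phi> p) = P ?z" "\<exists>P\<in>opers. lin (\<phi> q) = P ?z"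
    then obtain P Q where "P \<in> opers" "Q \<in> opers" "lin (\<phi> p) = P ?z" "lin (\<phi> q) = Q ?z"
      by blast
    then show "\<exists>P\<in>opers. lin (\<phi> (p + q)) = P ?z"
      by (intro bexI[of _ "\<lambda>p. P p + Q p"] opers.add) (simp_all add: \<phi> lin_add)
  next
    fix m :: "'d dvariable multiset" and c :: 'k
    assume "\<And>v. v \<in># m \<Longrightarrow> fst v = l"
    then show "\<exists>P\<in>opers. lin (\<phi> (Poly_Mapping.single m c)) = P ?z"
    proof (induction m)
      case empty
      have "\<phi> (Poly_Mapping.single {#} c) = dconst c"
        using \<phi>(3)[of c] by (simp add: dconst_def)
      then show ?case using opers_zero by (intro bexI[of _ "\<lambda>p. 0"]) auto
    next
      case (add v m)
      then obtain P where P: "P \<in> opers" "lin (\<phi> (Poly_Mapping.single m c)) = P ?z" by auto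
      obtain \<theta> where v: "v = (l, \<theta>)" using add(2)[of v] by (cases v) auto
      obtain Q where Q: "Q \<in> opers" "lin (\<phi> (dvar l \<theta>)) = Q ?z" using var by blast
      have "Poly_Mapping.single (add_mset v m) c = dvar l \<theta> * Poly_Mapping.single m c"
        by (simp add: dvar_def mult_single v)
      then have "lin (\<phi> (Poly_Mapping.single (add_mset v m) c)) =
          cst (const_part (\<phi> (dvar l \<theta>))) * P ?z +
          cst (const_part (\<phi> (Poly_Mapping.single m c))) * Q ?z"
        by (simp add: \<phi> lin_mult P Q)
      then show ?case
        using opers.add[OF opers.smult[OF P(1)] opers.smult[OF Q(1)]] by (rule bexI)
    qed
  qed
qed


section \<open>Tame automorphisms\<close>

lemma elementary_cases:
  assumes "e \<in> elementary D"
  obtains l l' a f where "{l, l'} = {Lx, Ly}" "a \<noteq> 0" "f \<in> dpoly_in l'" "e \<in> carrier (dAut D)"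
    "e (dvar l {#}) = dconst a * dvar l {#} + f" "e (dvar l' {#}) = dvar l' {#}"
  using assms unfolding elementary_def dpair_def by blast

abbreviation reachable :: "(('d, 'k) dpoly \<Rightarrow> ('d, 'k) dpoly) \<Rightarrow> bool" where
  "reachable \<psi> \<equiv> reach (lin (\<psi> dx)) (lin (\<psi> dy))"

lemma reachable_eq:
  "{l, l'} = {Lx, Ly} \<Longrightarrow> reachable \<psi> \<longleftrightarrow> reach (lin (\<psi> (dvar l {#}))) (lin (\<psi> (dvar l' {#})))"
  by (auto simp: doubleton_eq_iff intro: reach_sym)

lemma reachable_elementary:
  assumes "dhom \<psi>" "e \<in> elementary D" "reachable \<psi>"
  shows "reachable (\<psi> \<circ> e)"
proof -
  obtain l l' a f where e: "{l, l'} = {Lx, Ly}" "a \<noteq> 0" "f \<in> dpoly_in l'"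
    "e (dvar l {#}) = dconst a * dvar l {#} + f" "e (dvar l' {#}) = dvar l' {#}"
    using elementary_cases[OF assms(2)] by metis
  let ?x = "dvar l {#}" and ?y = "dvar l' {#}"
  obtain P where P: "P \<in> opers" "lin (\<psi> f) = P (lin (\<psi> ?y))"
    using lin_dhom_dpoly_in[OF assms(1) e(3)] by blast
  have "lin ((\<psi> \<circ> e) ?x) = cst a * lin (\<psi> ?x) + P (lin (\<psi> ?y))"
    by (simp add: e dhomD[OF assms(1)] lin_add lin_mult const_part_simps P)
  then show ?thesis
    using reach_move[OF _ e(2) P(1)] assms(3) unfolding reachable_eq[OF e(1)] by (simp add: e)
qed

text \<open>Since \<open>\<chi> \<circ> e = \<psi>\<close> and \<open>\<chi>\<close> agrees with \<open>\<psi>\<close> on the variable that \<open>e\<close> fixes, the elementary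
  move can be solved for the other entry.\<close>

lemma reachable_inv_elementary:
  assumes "dhom \<psi>" "dhom \<chi>" "e \<in> elementary D" "\<chi> \<circ> e = \<psi>" "reachable \<psi>"
  shows "reachable \<chi>"
proof -
  obtain l l' a f where e: "{l, l'} = {Lx, Ly}" "a \<noteq> 0" "f \<in> dpoly_in l'"
    "e (dvar l {#}) = dconst a * dvar l {#} + f" "e (dvar l' {#}) = dvar l' {#}"
    using elementary_cases[OF assms(3)] by metis
  let ?x = "dvar l {#}" and ?y = "dvar l' {#}"
  have y: "\<chi> ?y = \<psi> ?y" using fun_cong[OF assms(4), of ?y] by (simp add: e)
  obtain P where P: "P \<in> opers" "lin (\<chi> f) = P (lin (\<psi> ?y))"
    using lin_dhom_dpoly_in[OF assms(2) e(3)] y by auto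
  have "\<psi> ?x = dconst a * \<chi> ?x + \<chi> f"
    using fun_cong[OF assms(4), of ?x] by (simp add: e dhomD[OF assms(2)])
  then have "lin (\<psi> ?x) = cst a * lin (\<chi> ?x) + P (lin (\<psi> ?y))"
    by (simp add: lin_add lin_mult const_part_simps P)
  then have *: "cst (inverse a) * lin (\<psi> ?x) =
      (cst (inverse a) * cst a) * lin (\<chi> ?x) + cst (inverse a) * P (lin (\<psi> ?y))"
    by (simp add: distrib_left mult.assoc)
  have **: "cst (inverse a) * cst a = 1" using e(2) by (simp add: mult_single)
  have "cst (- inverse a) * P (lin (\<psi> ?y)) = - (cst (inverse a) * P (lin (\<psi> ?y)))"
    by (simp add: single_uminus)
  then have "lin (\<chi> ?x) =
      cst (inverse a) * lin (\<psi> ?x) + cst (- inverse a) * P (lin (\<psi> ?y))"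
    using * unfolding ** by (simp only: mult_1 add.assoc right_minus add_0_right)
  then show ?thesis
    using reach_move[OF _ _ opers.smult[OF P(1)], of _ _ "inverse a" "- inverse a"] assms(5) e(2)
    unfolding reachable_eq[OF e(1)] by (simp add: y)
qed

lemma reachable_tame:
  assumes "tame D \<phi>"
  shows "reachable \<phi>"
proof -
  interpret G: group "dAut D" by (rule group_dAut)
  have E: "elementary D \<subseteq> carrier (dAut D)"
    by (auto simp: elementary_def dpair_def)
  have mult: "\<phi> \<otimes>\<^bsub>dAut D\<^esub> \<psi> = \<phi> \<circ> \<psi>" "\<one>\<^bsub>dAut D\<^esub> = id" for \<phi> \<psi>
    by (simp_all add: dAut_def)
  \<comment> \<open>Generalized over a left factor \<open>\<psi>\<close>, since moves correspond to factors on the right.\<close>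
  have "\<forall>\<psi>\<in>carrier (dAut D). reachable \<psi> \<longrightarrow> reachable (\<psi> \<circ> \<phi>)"
    using assms unfolding tame_def
  proof (induction \<phi> rule: generate.induct)
    case one
    show ?case by (simp add: mult)
  next
    case (incl e)
    then show ?case using reachable_elementary by (simp add: in_dAut_iff)
  next
    case (inv e)
    show ?case
    proof (intro ballI impI)
      fix \<psi> assume \<psi>: "\<psi> \<in> carrier (dAut D)" "reachable \<psi>"
      have e: "e \<in> carrier (dAut D)" using inv E by blast
      have "\<psi> \<circ> inv\<^bsub>dAut D\<^esub> e \<in> carrier (dAut D)"
        using G.m_closed[OF \<psi>(1) G.inv_closed[OF e]] by (simp add: mult)
      then have \<chi>: "dhom (\<psi> \<circ> inv\<^bsub>dAut D\<^esub> e)" by (simp only: in_dAut_iff)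
      have "(\<psi> \<circ> inv\<^bsub>dAut D\<^esub> e) \<circ> e = \<psi>"
        using G.l_inv[OF e] by (simp add: mult comp_assoc)
      then show "reachable (\<psi> \<circ> inv\<^bsub>dAut D\<^esub> e)"
        using \<psi>(1) unfolding in_dAut_iff
        by (elim conjE) (rule reachable_inv_elementary[OF _ \<chi> inv _ \<psi>(2)])
    qed
  next
    case (eng h1 h2)
    have "h1 \<in> carrier (dAut D)"
      using eng(1) G.generate_incl[OF E] by blast
    then have "\<psi> \<circ> h1 \<in> carrier (dAut D)" if "\<psi> \<in> carrier (dAut D)" for \<psi>
      using G.m_closed[OF that] by (simp add: mult)
    then show ?case
      using eng(3,4) unfolding mult(1) comp_assoc[symmetric] by blast
  qed
  moreover have "id \<in> carrier (dAut D)" by (simp add: in_dAut_iff dhom_id)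
  moreover have "reachable id" using reach_start by simp
  ultimately show ?thesis by fastforce
qed

lemma not_reach_cohn_pair:
  assumes "i \<noteq> j"
  shows "\<not> reach (cst 1 + Poly_Mapping.single {#i, j#} 1) (Poly_Mapping.single {#i, i#} 1)"
proof
  assume r: "reach (cst 1 + Poly_Mapping.single {#i, j#} 1) (Poly_Mapping.single {#i, i#} 1)"
  have "leads (Poly_Mapping.single {#i, j#} 1 + cst 1) {#i, j#}"
    by (intro leads_add leads_single lower_single rank_less_subset) auto
  then have "leads (cst 1 + Poly_Mapping.single {#i, j#} 1) {#i, j#}"
    by (simp only: add.commute)
  then have "{#i, j#} \<subseteq># {#i, i#} \<or> {#i, i#} \<subseteq># {#i, j#}"
    by (rule reach_leads[OF r _ leads_single]) simp
  then show False using assms by auto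
qed

end

theorem mainTheorem3:
  fixes D :: "'d::finite \<Rightarrow> 'k::field_char_0 \<Rightarrow> 'k"
    and \<delta>\<^sub>1 \<delta>\<^sub>2 :: 'd
    and w :: "('d, 'k) dpoly"
  assumes "differential_field D"
    and "CARD('d) \<ge> 2"
    and "\<delta>\<^sub>1 \<noteq> \<delta>\<^sub>2"
    and "w = dact D \<delta>\<^sub>1 dx - dact D \<delta>\<^sub>2 dy"
  shows "(\<exists>!\<delta>. dpair D \<delta> (dx + dact D \<delta>\<^sub>2 w) (dy + dact D \<delta>\<^sub>1 w)) \<and>
         (\<forall>\<delta>. dpair D \<delta> (dx + dact D \<delta>\<^sub>2 w) (dy + dact D \<delta>\<^sub>1 w) \<longrightarrow> wild D \<delta>)"
proof -
  interpret diff_field D by standard (rule assms(1))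
  let ?f = "dx + dact D \<delta>\<^sub>2 w" and ?g = "dy + dact D \<delta>\<^sub>1 w"
  note w = assms(4)
  have comm: "dact D \<delta>\<^sub>2 (dact D \<delta>\<^sub>1 p) = dact D \<delta>\<^sub>1 (dact D \<delta>\<^sub>2 p)" for p
    by (rule dact_commute[OF assms(1)])
  obtain \<phi> where \<phi>: "dhom \<phi>" "\<phi> dx = ?f" "\<phi> dy = ?g"
    using dhom_exists by blast
  obtain \<psi> where \<psi>: "dhom \<psi>" "\<psi> dx = dx - dact D \<delta>\<^sub>2 w" "\<psi> dy = dy - dact D \<delta>\<^sub>1 w"
    using dhom_exists by blast
  have "\<phi> w = dact D \<delta>\<^sub>1 ?f - dact D \<delta>\<^sub>2 ?g"
    using \<phi> by (simp add: w dhom_diff dhomD)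
  then have \<phi>w: "\<phi> w = w" by (simp add: dact_plus comm w[symmetric])
  have "\<psi> w = dact D \<delta>\<^sub>1 (\<psi> dx) - dact D \<delta>\<^sub>2 (\<psi> dy)"
    using \<psi>(1) by (simp add: w dhom_diff dhomD)
  then have \<psi>w: "\<psi> w = w" by (simp add: \<psi> dact_diff comm w[symmetric])
  have "\<phi> \<circ> \<psi> = id" "\<psi> \<circ> \<phi> = id"
    by (intro dhom_eqI dhom_comp dhom_id \<phi> \<psi>;
        simp add: \<phi> \<psi> dhomD[OF \<phi>(1)] dhomD[OF \<psi>(1)] dhom_diff[OF \<phi>(1)] \<phi>w \<psi>w)+
  then have "bij \<phi>" using o_bij by blast
  then have pair: "dpair D \<phi> ?f ?g"
    using \<phi> by (simp add: dpair_def in_dAut_iff)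
  moreover have "\<delta> = \<phi>" if "dpair D \<delta> ?f ?g" for \<delta>
    using that \<phi> by (intro dhom_eqI) (simp_all add: dpair_def in_dAut_iff)
  moreover have "\<not> tame D \<phi>"
  proof
    assume "tame D \<phi>"
    then have "reach (lin ?f) (lin ?g)" using reachable_tame \<phi> by metis
    moreover have "lin ?f = cst 1 + Poly_Mapping.single {#\<delta>\<^sub>1, \<delta>\<^sub>2#} 1"
      by (simp add: w lin_add lin_diff dact_var dact_diff add_mset_commute)
    moreover have "lin ?g = Poly_Mapping.single {#\<delta>\<^sub>1, \<delta>\<^sub>1#} 1"
      by (simp add: w lin_add lin_diff dact_var dact_diff)
    ultimately show False using not_reach_cohn_pair[OF assms(3)] by simp
  qed
  ultimately show ?thesis unfolding wild_def dpair_def by blast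
qed

end
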